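(* Let $X$ be a complete metric space and let $E\subseteq X$ be a $G_\delta$-set in $X$ which (with the subspace topology) is arcwise connected and locally arcwise connected. Then $E$ is a $B_1$-retract of $X$.
   Context: A function $f:X\to Y$ between topological spaces is a Baire-one function if it is the pointwise limit of a sequence of continuous functions $f_n:X\to Y$. A subset $E$ of $X$ (with the subspace topology) is a $B_1$-retract of $X$ if there exists a Baire-one function $r:X\to E$ with $r(x)=x$ for all $x\in E$. A space is locally arcwise connected if for every $x$ and every neighbourhood $U$ of $x$ there is a neighbourhood $V$ of $x$ such that every $y\in V$ is joined to $x$ by a path in $U$. *)

theory Defs
  imports "HOL-Analysis.Analysis"
begin

definition arcwise_connected :: "'a::topological_space set \<Rightarrow> bool" where
  "arcwise_connected E \<longleftrightarrow>
     (\<forall>x\<in>E. \<forall>y\<in>E. x \<noteq> y \<longrightarrow>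
        (\<exists>g. arc g \<and> path_image g \<subseteq> E \<and> pathstart g = x \<and> pathfinish g = y))"

text \<open>Locally arcwise connected (as in the paper, via paths), for E with the subspace topology.\<close>
definition locally_arcwise_connected :: "'a::topological_space set \<Rightarrow> bool" where
  "locally_arcwise_connected E \<longleftrightarrow>
     (\<forall>x\<in>E. \<forall>U. openin (top_of_set E) U \<and> x \<in> U \<longrightarrow>
        (\<exists>V. openin (top_of_set E) V \<and> x \<in> V \<and>
           (\<forall>y\<in>V. \<exists>g. path g \<and> path_image g \<subseteq> U \<and> pathstart g = x \<and> pathfinish g = y)))"

definition baire_one_into :: "'a set \<Rightarrow> ('b::topological_space \<Rightarrow> 'a::topological_space) \<Rightarrow> bool" where
  "baire_one_into E f \<longleftrightarrow> f ` UNIV \<subseteq> E \<and>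
     (\<exists>fs :: nat \<Rightarrow> 'b \<Rightarrow> 'a. (\<forall>n. continuous_on UNIV (fs n) \<and> fs n ` UNIV \<subseteq> E) \<and>
        (\<forall>x. (\<lambda>n. fs n x) \<longlonglongrightarrow> f x))"

definition B1_retract :: "'a::topological_space set \<Rightarrow> bool" where
  "B1_retract E \<longleftrightarrow> (\<exists>r. baire_one_into E r \<and> (\<forall>x\<in>E. r x = x))"

end

theory Submission
  imports Defs
begin

text \<open>
  Write \<open>E\<close> as the intersection of open sets \<open>F n\<close> and, at level \<open>n\<close>, cover \<open>E\<close> by balls contained in
  \<open>F n\<close> in which any two points of \<open>E\<close> are joined by a path in \<open>E\<close> of size at most \<open>2 / (n + 1)\<close>.
  Labelling a point by the first of these balls containing it (or by \<open>None\<close>) yields a tree of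
  partitions of \<open>X\<close>. Give each cell a point of \<open>E\<close>: one inside the cell if the cell meets \<open>E\<close>,
  and the point of the parent cell otherwise. Along the branch of \<open>x \<in> E\<close> these points converge to
  \<open>x\<close>; along the branch of \<open>x \<notin> E\<close> they become stationary, since \<open>x \<notin> F n\<close> for some \<open>n\<close> and then the
  cell of \<open>x\<close> misses \<open>E\<close> from there on. The limit is the retraction. Each partition is an increasing
  union over \<open>m\<close> of parts on which distinct cells lie at distance at least \<open>1 / (m + 1)\<close>; the \<open>m\<close>-th
  continuous approximation is constant near the separated parts of the first \<open>m\<close> levels and
  moves along the small paths from the point of a cell to that of a subcell in between.
\<close>

text \<open>
  This is the decomposition in Stone's proof of paracompactness: with respect to a well-order of the
  centres, \<open>L x\<close> is the first ball containing \<open>x\<close>, and \<open>Z m\<close> consists of the points that lie at depth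
  at least \<open>1 / (m + 1)\<close> in that ball.
\<close>
lemma separated_labelling:
  fixes E :: "'a::metric_space set" and \<rho> :: "'a \<Rightarrow> real"
  obtains L :: "'a \<Rightarrow> 'a option" and Z :: "nat \<Rightarrow> 'a set"
  where "\<And>x e. L x = Some e \<Longrightarrow> e \<in> E \<and> dist e x < \<rho> e"
    and "\<And>x e. L x = None \<Longrightarrow> e \<in> E \<Longrightarrow> \<rho> e \<le> dist e x"
    and "\<And>x. \<forall>\<^sub>F m in sequentially. x \<in> Z m"
    and "\<And>m x x'. \<lbrakk>x \<in> Z m; x' \<in> Z m; dist x x' < 1 / Suc m\<rbrakk> \<Longrightarrow> L x = L x'"
proof -
  obtain r :: "'a rel" where r: "Well_order r" "Field r = UNIV"
    using well_ordering[where 'a = 'a] by auto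
  interpret wo_rel r
    using r(1) by (rule wo_rel.intro)
  define S where "S x = {e \<in> E. dist e x < \<rho> e}" for x
  define L where "L x = (if S x = {} then None else Some (minim (S x)))" for x
  define Z where "Z m = {x. \<forall>e. L x = Some e \<longrightarrow> dist e x + 1 / Suc m \<le> \<rho> e}" for m :: nat
  have L_min: "e \<in> S x \<and> (\<forall>e'\<in>S x. (e, e') \<in> r)" if "L x = Some e" for x e
  proof -
    have "S x \<noteq> {}" "e = minim (S x)"
      using that by (simp_all add: L_def split: if_splits)
    then show ?thesis
      using minim_isMinim[of "S x"] r(2) by (simp add: isMinim_def)
  qed
  have L_None: "L x = None \<longleftrightarrow> S x = {}" for x
    by (simp add: L_def)
  have mem: "e \<in> S x'" if "x \<in> Z m" "dist x x' < 1 / Suc m" "L x = Some e" for x x' e m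
  proof -
    have "dist e x + 1 / Suc m \<le> \<rho> e"
      using that by (simp add: Z_def)
    with dist_triangle[of e x' x] that(2) have "dist e x' < \<rho> e"
      by linarith
    then show ?thesis
      using L_min[OF that(3)] by (simp add: S_def)
  qed
  show ?thesis
  proof
    show "e \<in> E \<and> dist e x < \<rho> e" if "L x = Some e" for x e
      using L_min[OF that] by (simp add: S_def)
    show "\<rho> e \<le> dist e x" if "L x = None" "e \<in> E" for x e
      using that by (auto simp: L_None S_def)
    show "\<forall>\<^sub>F m in sequentially. x \<in> Z m" for x
    proof (cases "L x")
      case None
      then show ?thesis by (simp add: Z_def)
    next
      case (Some e)
      then have "0 < \<rho> e - dist e x"
        using L_min by (force simp: S_def)
      then have "\<forall>\<^sub>F m in sequentially. 1 / real (Suc m) < \<rho> e - dist e x"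
        by (rule order_tendstoD(2)[OF LIMSEQ_Suc[OF lim_1_over_n]])
      then show ?thesis
        by eventually_elim (simp add: Z_def Some)
    qed
    \<comment> \<open>The depth margin puts the label of each point among the candidates
      \<open>S\<close> of the other, so each label precedes the other in the well-order. A lone
      label is impossible, as the unlabelled point would have a candidate.\<close>
    show "L x = L x'" if "x \<in> Z m" "x' \<in> Z m" "dist x x' < 1 / Suc m" for m x x'
    proof (cases "L x")
      case None
      then show ?thesis
        using mem[OF that(2), of x] that(3) L_None[of x] by (cases "L x'") (auto simp: dist_commute)
    next
      case (Some e)
      then have "e \<in> S x'"
        using mem that by blast
      then obtain e' where e': "L x' = Some e'"
        using L_None by (cases "L x'") auto
      then have "e' \<in> S x"
        using mem[OF that(2), of x] that(3) by (simp add: dist_commute)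
      then have "e = e'"
        using L_min[OF Some] L_min[OF e'] \<open>e \<in> S x'\<close> ANTISYM by (meson antisymD)
      then show ?thesis
        using Some e' by simp
    qed
  qed
qed

text \<open>Near \<open>C\<close> the new map runs along \<open>\<gamma> z\<close> up to time
  \<open>\<phi> x\<close>, a cutoff that is 1 within \<delta> of \<open>C\<close> and 0 from
  distance 2\<delta> on. Between 2\<delta> and 3\<delta> it sits at the start of the path, where it
  agrees with \<open>f\<close>, so the two pieces glue.\<close>

lemma continuous_shift_along_paths:
  fixes f :: "'a::metric_space \<Rightarrow> 'b::topological_space" and \<gamma> :: "'a \<Rightarrow> real \<Rightarrow> 'b"
  assumes f: "continuous_on UNIV f" and "\<delta> > 0"
    and path: "\<And>z. z \<in> C \<Longrightarrow> path (\<gamma> z)"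
    and sep: "\<And>z z'. \<lbrakk>z \<in> C; z' \<in> C; dist z z' < 6 * \<delta>\<rbrakk> \<Longrightarrow> \<gamma> z = \<gamma> z'"
    and start: "\<And>z x. \<lbrakk>z \<in> C; dist z x < 3 * \<delta>\<rbrakk> \<Longrightarrow> f x = \<gamma> z 0"
  obtains g where "continuous_on UNIV g"
    and "\<And>z x. \<lbrakk>z \<in> C; dist z x < \<delta>\<rbrakk> \<Longrightarrow> g x = \<gamma> z 1"
    and "\<And>x. g x = f x \<or> (\<exists>z\<in>C. dist z x < 3 * \<delta> \<and> g x \<in> \<gamma> z ` {0..1})"
proof -
  define \<phi> where "\<phi> x = max 0 (min 1 (2 - infdist x C / \<delta>))" for x
  define near where "near x z \<longleftrightarrow> z \<in> C \<and> dist z x < 3 * \<delta>" for x z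
  define g where "g x = (if \<exists>z. near x z then \<gamma> (SOME z. near x z) (\<phi> x) else f x)" for x
  have \<phi>01: "\<phi> x \<in> {0..1}" for x
    by (auto simp: \<phi>_def)
  have \<phi>_cont: "continuous_on A \<phi>" for A
    unfolding \<phi>_def using \<open>\<delta> > 0\<close> by (intro continuous_intros) auto
  have g_near: "g x = \<gamma> z (\<phi> x)" if "near x z" for x z
  proof -
    define w where "w = (SOME z. near x z)"
    have w: "near x w"
      unfolding w_def using that by (rule someI)
    \<comment> \<open>Two points of \<open>C\<close> that are both near \<open>x\<close> carry the
      same path, so the choice made by \<open>SOME\<close> in \<open>g\<close> is
      immaterial.\<close>
    have "dist w z < 6 * \<delta>"
      using w that dist_triangle2[of w z x] by (auto simp: near_def)
    then have "\<gamma> w = \<gamma> z"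
      using sep w that by (auto simp: near_def)
    then show ?thesis
      using that by (auto simp: g_def w_def)
  qed
  have "\<exists>T. open T \<and> x \<in> T \<and> continuous_on T g" for x
  proof (cases "\<exists>z. near x z")
    case True
    then obtain z where z: "near x z" by blast
    have "continuous_on (ball z (3 * \<delta>)) (\<gamma> z \<circ> \<phi>)"
    proof (rule continuous_on_compose[OF \<phi>_cont])
      have "continuous_on {0..1} (\<gamma> z)"
        using path z by (simp add: near_def path_def)
      then show "continuous_on (\<phi> ` ball z (3 * \<delta>)) (\<gamma> z)"
        by (rule continuous_on_subset) (use \<phi>01 in blast)
    qed
    then have "continuous_on (ball z (3 * \<delta>)) g"
      by (rule continuous_on_eq) (use z in \<open>auto simp: near_def g_near\<close>)
    with z show ?thesis
      by (intro exI[of _ "ball z (3 * \<delta>)"]) (auto simp: near_def)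
  next
    case False
    have "g x' = f x'" if x': "x' \<in> ball x \<delta>" for x'
    proof (cases "\<exists>z. near x' z")
      case True
      then obtain z where z: "near x' z" by blast
      \<comment> \<open>This is needed because \<open>infdist\<close> to the empty set is 0 by
        convention.\<close>
      then have "C \<noteq> {}"
        by (auto simp: near_def)
      then have "2 * \<delta> \<le> infdist x' C"
      proof (unfold infdist_notempty, intro cINF_greatest)
        fix a assume "a \<in> C"
        then have "3 * \<delta> \<le> dist a x"
          using False by (auto simp: near_def not_less)
        then show "2 * \<delta> \<le> dist x' a"
          using x' dist_triangle[of a x x'] by (auto simp: dist_commute)
      qed
      then have "\<phi> x' = 0"
        using \<open>\<delta> > 0\<close> by (auto simp: \<phi>_def field_simps max_def min_def)
      then show ?thesis
        using g_near[OF z] start z by (auto simp: near_def)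
    qed (simp add: g_def)
    then have "continuous_on (ball x \<delta>) g"
      using continuous_on_subset[OF f] by (subst continuous_on_cong[where g = f]) auto
    then show ?thesis
      using \<open>\<delta> > 0\<close> by (intro exI[of _ "ball x \<delta>"]) auto
  qed
  then have "continuous_on UNIV g"
    by (metis UNIV_I continuous_at_imp_continuous_on continuous_on_eq_continuous_at)
  moreover have "g x = \<gamma> z 1" if "z \<in> C" "dist z x < \<delta>" for z x
  proof -
    have "infdist x C \<le> dist x z"
      using that by (simp add: infdist_le)
    with that \<open>\<delta> > 0\<close> have "\<phi> x = 1"
      by (auto simp: \<phi>_def dist_commute max_def min_def field_simps)
    then show ?thesis
      using g_near[of x z] that \<open>\<delta> > 0\<close> by (auto simp: near_def)
  qed
  moreover have "g x = f x \<or> (\<exists>z\<in>C. dist z x < 3 * \<delta> \<and> g x \<in> \<gamma> z ` {0..1})" for x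
  proof (cases "\<exists>z. near x z")
    case True
    then show ?thesis
      using g_near \<phi>01 unfolding near_def by blast
  qed (simp add: g_def)
  ultimately show ?thesis
    using that by blast
qed

text \<open>One shift along paths is made per level, each near the points that lie in all separated
  parts so far. Later shifts change the value at a point of the first \<open>j\<close> parts only
  along paths of level at least \<open>j\<close> whose base point has the same first
  \<open>j\<close> labels; this is what makes the approximations converge.\<close>

lemma continuous_along_nested_labels:
  fixes L :: "nat \<Rightarrow> 'a::metric_space \<Rightarrow> 'c" and Y :: "nat \<Rightarrow> 'a \<Rightarrow> 'b::topological_space"
    and \<gamma> :: "nat \<Rightarrow> 'a \<Rightarrow> real \<Rightarrow> 'b" and Z :: "nat \<Rightarrow> 'a set" and n :: nat
  defines "eqv \<equiv> \<lambda>n x x'. \<forall>i<n. L i x = L i x'"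
  assumes "d > 0"
    and sep: "\<And>i x x'. \<lbrakk>x \<in> Z i; x' \<in> Z i; dist x x' < d\<rbrakk> \<Longrightarrow> L i x = L i x'"
    and path: "\<And>n x. path (\<gamma> n x)"
    and start: "\<And>n x. pathstart (\<gamma> n x) = Y n x"
    and finish: "\<And>n x. pathfinish (\<gamma> n x) = Y (Suc n) x"
    and Y_eqv: "\<And>n x x'. eqv n x x' \<Longrightarrow> Y n x = Y n x'"
    and \<gamma>_eqv: "\<And>n x x'. eqv (Suc n) x x' \<Longrightarrow> \<gamma> n x = \<gamma> n x'"
  shows "\<exists>g. continuous_on UNIV g \<and>
           (\<forall>j\<le>n. \<forall>x\<in>(\<Inter>i<j. Z i). \<exists>k\<ge>j. \<exists>z. eqv j x z \<and> g x \<in> path_image (\<gamma> k z))"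
proof -
  define C where "C n = (\<Inter>i<n. Z i)" for n
  \<comment> \<open>The factor 6 meets the separation demanded by a shift. The ratio 3 makes the
    zone of the next shift, of width \<open>3 * \<delta> (Suc n)\<close>, fit exactly where the
    current map is constant.\<close>
  define \<delta> where "\<delta> n = d / 6 / 3 ^ n" for n :: nat
  have \<delta>_pos: "\<delta> n > 0" and \<delta>_Suc: "3 * \<delta> (Suc n) = \<delta> n" for n
    using \<open>d > 0\<close> by (auto simp: \<delta>_def)
  have \<delta>_le: "6 * \<delta> n \<le> d" for n
    using \<open>d > 0\<close> by (simp add: \<delta>_def field_simps)
  have C_eqv: "eqv n x x'" if "x \<in> C n" "x' \<in> C n" "dist x x' < d" for n x x'
    using that sep by (auto simp: C_def eqv_def)
  have C_anti: "C n \<subseteq> C j" if "j \<le> n" for j n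
    using that by (auto simp: C_def)
  \<comment> \<open>The induction also carries that the map equals \<open>Y n z\<close> near each
    \<open>z\<close> in \<open>C n\<close>, so that the next paths start at its values.\<close>
  have "\<exists>g. continuous_on UNIV g \<and> (\<forall>z\<in>C n. \<forall>x. dist z x < \<delta> n \<longrightarrow> g x = Y n z) \<and>
     (\<forall>j\<le>n. \<forall>x\<in>C j. \<exists>k\<ge>j. \<exists>z. eqv j x z \<and> g x \<in> path_image (\<gamma> k z))"
  proof (induction n)
    case 0
    have Y0: "Y 0 x = Y 0 x'" for x x'
      by (rule Y_eqv) (simp add: eqv_def)
    have "Y 0 x \<in> path_image (\<gamma> 0 x)" for x
      using start pathstart_in_path_image by metis
    then show ?case
      using Y0 by (intro exI[of _ "\<lambda>x. Y 0 undefined"]) (auto simp: eqv_def)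
  next
    case (Suc n)
    then obtain f where f: "continuous_on UNIV f"
      and f_Y: "\<And>z x. \<lbrakk>z \<in> C n; dist z x < \<delta> n\<rbrakk> \<Longrightarrow> f x = Y n z"
      and f_path: "\<And>j x. \<lbrakk>j \<le> n; x \<in> C j\<rbrakk> \<Longrightarrow> \<exists>k\<ge>j. \<exists>z. eqv j x z \<and> f x \<in> path_image (\<gamma> k z)"
      by auto
    obtain g where g: "continuous_on UNIV g"
      and g_Y: "\<And>z x. \<lbrakk>z \<in> C (Suc n); dist z x < \<delta> (Suc n)\<rbrakk> \<Longrightarrow> g x = \<gamma> n z 1"
      and g_path: "\<And>x. g x = f x \<or>
         (\<exists>z\<in>C (Suc n). dist z x < 3 * \<delta> (Suc n) \<and> g x \<in> \<gamma> n z ` {0..1})"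
    proof (rule continuous_shift_along_paths[OF f \<delta>_pos[of "Suc n"], of "C (Suc n)" "\<gamma> n"])
      show "\<gamma> n z = \<gamma> n z'"
        if "z \<in> C (Suc n)" "z' \<in> C (Suc n)" "dist z z' < 6 * \<delta> (Suc n)" for z z'
        using that \<delta>_le[of "Suc n"] by (intro \<gamma>_eqv C_eqv) auto
      show "f x = \<gamma> n z 0" if "z \<in> C (Suc n)" "dist z x < 3 * \<delta> (Suc n)" for z x
        using that f_Y[of z x] C_anti[of n "Suc n"] start[of n z] by (auto simp: \<delta>_Suc pathstart_def)
    qed (use path in auto)
    have g_Y': "g x = Y (Suc n) z" if "z \<in> C (Suc n)" "dist z x < \<delta> (Suc n)" for z x
      using g_Y[OF that] finish by (metis pathfinish_def)
    have "\<exists>k\<ge>j. \<exists>z. eqv j x z \<and> g x \<in> path_image (\<gamma> k z)" if j: "j \<le> Suc n" and x: "x \<in> C j" for j x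
    proof (cases "j = Suc n")
      case True
      \<comment> \<open>At the new level the value is an endpoint of the path just used, counted as
        the start of the following one.\<close>
      then have "g x = pathstart (\<gamma> (Suc n) x)"
        using g_Y'[of x x] x \<delta>_pos by (simp add: start)
      then show ?thesis
        using True by (intro exI[of _ j] exI[of _ x] conjI) (auto simp: eqv_def)
    next
      case False
      with j have "j \<le> n" by simp
      from g_path[of x] consider "g x = f x"
        | z where "z \<in> C (Suc n)" "dist z x < 3 * \<delta> (Suc n)" "g x \<in> \<gamma> n z ` {0..1}"
        by blast
      then show ?thesis
      proof cases
        case 1
        then show ?thesis
          using f_path[OF \<open>j \<le> n\<close> x] by simp
      next
        case (2 z)
        \<comment> \<open>Both points lie in \<open>C j\<close> at distance below
          \<open>\<delta> n\<close>, hence below \<open>d\<close>, so separation at each level under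
          \<open>j\<close> applies.\<close>
        then have "eqv j x z"
          using C_anti[OF j] \<delta>_le[of n] \<delta>_pos[of n] x
          by (intro C_eqv) (auto simp: \<delta>_Suc dist_commute)
        with 2 \<open>j \<le> n\<close> show ?thesis
          by (auto simp: path_image_def)
      qed
    qed
    with g g_Y' show ?case
      by blast
  qed
  then show ?thesis
    unfolding C_def by blast
qed

text \<open>Two points near \<open>e\<close> are joined through \<open>e\<close>: a reversed path to
  the centre is followed by a path out of it, and both stay in the same ball of radius
  \<epsilon>.\<close>

lemma locally_arcwise_connected_ball:
  fixes E :: "'a::metric_space set"
  assumes "locally_arcwise_connected E" "e \<in> E" "open U" "e \<in> U" "\<epsilon> > 0"
  shows "\<exists>\<rho>>0. ball e \<rho> \<subseteq> U \<and> (\<forall>a \<in> E \<inter> ball e \<rho>. \<forall>b \<in> E \<inter> ball e \<rho>.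
    \<exists>g. path g \<and> path_image g \<subseteq> E \<inter> ball e \<epsilon> \<and> pathstart g = a \<and> pathfinish g = b)"
proof -
  have "openin (top_of_set E) (E \<inter> ball e \<epsilon>)"
    by (simp add: openin_open_Int)
  with assms obtain V where V: "openin (top_of_set E) V" "e \<in> V"
    and V_path: "\<And>y. y \<in> V \<Longrightarrow>
      \<exists>g. path g \<and> path_image g \<subseteq> E \<inter> ball e \<epsilon> \<and> pathstart g = e \<and> pathfinish g = y"
    unfolding locally_arcwise_connected_def by (metis Int_iff centre_in_ball)
  obtain \<rho>1 where \<rho>1: "\<rho>1 > 0" "ball e \<rho>1 \<inter> E \<subseteq> V"
    using V by (auto simp: openin_contains_ball)
  obtain \<rho>2 where \<rho>2: "\<rho>2 > 0" "ball e \<rho>2 \<subseteq> U"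
    using assms open_contains_ball by blast
  show ?thesis
  proof (intro exI[of _ "min \<rho>1 \<rho>2"] conjI ballI)
    show "min \<rho>1 \<rho>2 > 0" "ball e (min \<rho>1 \<rho>2) \<subseteq> U"
      using \<rho>1 \<rho>2 by auto
    fix a b
    assume "a \<in> E \<inter> ball e (min \<rho>1 \<rho>2)" "b \<in> E \<inter> ball e (min \<rho>1 \<rho>2)"
    then have "a \<in> V" "b \<in> V"
      using \<rho>1 by auto
    then obtain g h where
      "path g" "path_image g \<subseteq> E \<inter> ball e \<epsilon>" "pathstart g = e" "pathfinish g = a"
      "path h" "path_image h \<subseteq> E \<inter> ball e \<epsilon>" "pathstart h = e" "pathfinish h = b"
      using V_path by metis
    then show "\<exists>g. path g \<and> path_image g \<subseteq> E \<inter> ball e \<epsilon> \<and> pathstart g = a \<and> pathfinish g = b"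
      by (intro exI[of _ "reversepath g +++ h"]) (simp add: path_image_join)
  qed
qed

lemma arcwise_connected_path:
  assumes "arcwise_connected E" "a \<in> E" "b \<in> E"
  shows "\<exists>g. path g \<and> path_image g \<subseteq> E \<and> pathstart g = a \<and> pathfinish g = b"
proof (cases "a = b")
  case True
  then show ?thesis
    using \<open>a \<in> E\<close>
    by (intro exI[of _ "\<lambda>_. a"]) (auto simp: path_def path_image_def pathstart_def pathfinish_def)
next
  case False
  then show ?thesis
    using assms unfolding arcwise_connected_def by (metis arc_imp_path)
qed

theorem theorem3p4:
  fixes E :: "'a::complete_space set"
  assumes "E \<noteq> {}"
    and "gdelta E"
    and "arcwise_connected E"
    and "locally_arcwise_connected E"
  shows "B1_retract E"
proof -

  \<comment> \<open>Small balls around points of \<open>E\<close> and the labels they induce\<close>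
  obtain F :: "nat \<Rightarrow> 'a set" where F_open: "\<And>n. open (F n)" and E_eq: "E = (\<Inter>n. F n)"
    using \<open>gdelta E\<close> by (auto elim: gdelta.cases)
  define radius where "radius n e \<rho> \<longleftrightarrow> \<rho> > 0 \<and> ball e \<rho> \<subseteq> F n \<and>
      (\<forall>a \<in> E \<inter> ball e \<rho>. \<forall>b \<in> E \<inter> ball e \<rho>. \<exists>g. path g \<and>
        path_image g \<subseteq> E \<inter> ball e (1 / Suc n) \<and> pathstart g = a \<and> pathfinish g = b)"
    for n e \<rho>
  define \<rho> where "\<rho> n e = (SOME \<rho>. radius n e \<rho>)" for n e
  have "radius n e (\<rho> n e)" if "e \<in> E" for e n
  proof -
    have "e \<in> F n" "1 / real (Suc n) > 0"
      using that E_eq by auto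
    then have "\<exists>\<rho>. radius n e \<rho>"
      unfolding radius_def using that F_open assms(4) by (intro locally_arcwise_connected_ball)
    then show ?thesis
      unfolding \<rho>_def by (rule someI_ex)
  qed
  then have \<rho>_pos: "\<And>n e. e \<in> E \<Longrightarrow> \<rho> n e > 0"
    and \<rho>_F: "\<And>n e. e \<in> E \<Longrightarrow> ball e (\<rho> n e) \<subseteq> F n"
    and \<rho>_path: "\<And>n e a b. \<lbrakk>e \<in> E; a \<in> E \<inter> ball e (\<rho> n e); b \<in> E \<inter> ball e (\<rho> n e)\<rbrakk> \<Longrightarrow>
       \<exists>g. path g \<and> path_image g \<subseteq> E \<inter> ball e (1 / Suc n) \<and> pathstart g = a \<and> pathfinish g = b"
    unfolding radius_def by blast+
  define labelling where "labelling n L Z \<longleftrightarrow>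
      (\<forall>x e. L x = Some e \<longrightarrow> e \<in> E \<and> dist e x < \<rho> n e) \<and>
      (\<forall>x. L x = None \<longrightarrow> (\<forall>e\<in>E. \<rho> n e \<le> dist e x)) \<and>
      (\<forall>x. \<forall>\<^sub>F m in sequentially. x \<in> Z m) \<and>
      (\<forall>m. \<forall>x\<in>Z m. \<forall>x'\<in>Z m. dist x x' < 1 / Suc m \<longrightarrow> L x = L x')"
    for n and L :: "'a \<Rightarrow> 'a option" and Z :: "nat \<Rightarrow> 'a set"
  have "\<exists>L Z. labelling n L Z" for n
    unfolding labelling_def by (rule separated_labelling[of E "\<rho> n"]) blast
  then obtain L Z where "\<And>n. labelling n (L n) (Z n)"
    by metis
  then have L_Some: "\<And>n x e. L n x = Some e \<Longrightarrow> e \<in> E \<and> dist e x < \<rho> n e"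
    and L_None: "\<And>n x e. \<lbrakk>L n x = None; e \<in> E\<rbrakk> \<Longrightarrow> \<rho> n e \<le> dist e x"
    and Z_ev: "\<And>n x. \<forall>\<^sub>F m in sequentially. x \<in> Z n m"
    and Z_sep: "\<And>n m x x'. \<lbrakk>x \<in> Z n m; x' \<in> Z n m; dist x x' < 1 / Suc m\<rbrakk> \<Longrightarrow> L n x = L n x'"
    unfolding labelling_def by blast+

  have L_E: "\<exists>c. L n e = Some c" if "e \<in> E" for n e
    using L_None[of n e e] \<rho>_pos[of e n] that by (cases "L n e") auto
  \<comment> \<open>Points of \<open>E\<close> are never labelled \<open>None\<close>, so equal
    labels mean a common ball; the bound is the diameter estimate for the ball of radius
    \<open>1 / Suc n\<close> containing the path.\<close>
  have label_path: "\<exists>g. path g \<and> path_image g \<subseteq> E \<and> pathstart g = a \<and> pathfinish g = b \<and>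
      (\<forall>p\<in>path_image g. dist p a < 2 / Suc n)"
    if "a \<in> E" "b \<in> E" "L n a = L n b" for n a b
  proof -
    obtain c where "L n a = Some c"
      using L_E[OF \<open>a \<in> E\<close>] by blast
    then have "c \<in> E" "a \<in> E \<inter> ball c (\<rho> n c)" "b \<in> E \<inter> ball c (\<rho> n c)"
      using that L_Some by (force simp: dist_commute)+
    from \<rho>_path[OF this] obtain g where g: "path g" "path_image g \<subseteq> E \<inter> ball c (1 / Suc n)"
        "pathstart g = a" "pathfinish g = b"
      by blast
    have "dist p a < 2 / Suc n" if "p \<in> path_image g" for p
    proof -
      have "p \<in> ball c (1 / Suc n)" "a \<in> ball c (1 / Suc n)"
        using that g pathstart_in_path_image[of g] by auto
      then show ?thesis
        using dist_triangle[of p a c] by (simp add: dist_commute)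
    qed
    with g show ?thesis
      by blast
  qed
  have label_dist: "dist b a < 2 / Suc n" if "a \<in> E" "b \<in> E" "L n a = L n b" for n a b
    using label_path[OF that] pathfinish_in_path_image by metis

  \<comment> \<open>Nested cells and their points in \<open>E\<close>\<close>
  define eqv where "eqv n x x' \<longleftrightarrow> (\<forall>i<n. L i x = L i x')" for n x x'
  have eqv_anti: "eqv k x x' \<Longrightarrow> j \<le> k \<Longrightarrow> eqv j x x'" for j k x x'
    by (auto simp: eqv_def)
  have eqv_sym: "eqv j x x' \<Longrightarrow> eqv j x' x" for j x x'
    by (auto simp: eqv_def)
  have eqv_trans: "eqv j x x' \<Longrightarrow> eqv j x' x'' \<Longrightarrow> eqv j x x''" for j x x' x''
    by (auto simp: eqv_def)

  obtain e0 where "e0 \<in> E"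
    using \<open>E \<noteq> {}\<close> by blast
  \<comment> \<open>The predicate under \<open>SOME\<close> involves \<open>x\<close> only through
    its cell, so the chosen point is constant on cells. A cell that misses \<open>E\<close> inherits
    the point of its parent.\<close>
  define Y where "Y = rec_nat (\<lambda>_. e0) (\<lambda>n y x.
     if \<exists>e\<in>E. eqv (Suc n) x e then SOME e. e \<in> E \<and> eqv (Suc n) x e else y x)"
  have Y_0: "Y 0 x = e0" for x
    by (simp add: Y_def)
  have Y_Suc: "Y (Suc n) x =
    (if \<exists>e\<in>E. eqv (Suc n) x e then SOME e. e \<in> E \<and> eqv (Suc n) x e else Y n x)" for n x
    by (simp add: Y_def)
  have Y_rep: "Y n x \<in> E \<and> eqv n x (Y n x)" if "e \<in> E" "eqv n x e" for n x e
  proof (cases n)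
    case 0
    then show ?thesis
      by (simp add: Y_0 \<open>e0 \<in> E\<close> eqv_def)
  next
    case (Suc k)
    then have "Y n x = (SOME e. e \<in> E \<and> eqv n x e)"
      using that by (auto simp: Y_Suc)
    with that show ?thesis
      by (metis (mono_tags, lifting) someI)
  qed
  have Y_E: "Y n x \<in> E" for n x
  proof (induction n)
    case 0
    then show ?case
      by (simp add: Y_0 \<open>e0 \<in> E\<close>)
  next
    case (Suc n)
    then show ?case
      using Y_rep[of _ "Suc n" x] by (cases "\<exists>e\<in>E. eqv (Suc n) x e") (auto simp: Y_Suc)
  qed
  have Y_cong: "Y n x = Y n x'" if "eqv n x x'" for n x x'
    using that
  proof (induction n)
    case (Suc n)
    then have "eqv (Suc n) x = eqv (Suc n) x'"
      using eqv_sym eqv_trans by blast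
    moreover have "Y n x = Y n x'"
      using Suc eqv_anti by simp
    ultimately show ?case
      by (simp add: Y_Suc)
  qed (simp add: Y_0)
  \<comment> \<open>If the cell of depth \<open>j\<close> meets \<open>E\<close>, every later point
    of the branch stays in that cell: it is either chosen in a smaller cell or inherited.\<close>
  have Y_stays: "eqv j x (Y k x)" if "e \<in> E" "eqv j x e" "j \<le> k" for j k x e
    using \<open>j \<le> k\<close>
  proof (induction k rule: dec_induct)
    case base
    then show ?case
      using Y_rep that by blast
  next
    case (step k)
    show ?case
    proof (cases "\<exists>e\<in>E. eqv (Suc k) x e")
      case True
      then show ?thesis
        using Y_rep eqv_anti step.hyps by (metis le_SucI)
    qed (use step in \<open>simp add: Y_Suc\<close>)
  qed
  have Y_stops: "Y k x = Y j x" if "\<not> (\<exists>e\<in>E. eqv j x e)" "j \<le> k" for j k x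
    using \<open>j \<le> k\<close>
  proof (induction k rule: dec_induct)
    case (step k)
    then show ?case
      using that(1) eqv_anti by (simp add: Y_Suc) (meson le_SucI)
  qed simp

  \<comment> \<open>Paths from the point of a cell to that of a subcell\<close>
  define good where "good n a b g \<longleftrightarrow> path g \<and> path_image g \<subseteq> E \<and> pathstart g = a \<and>
     pathfinish g = b \<and> (n > 0 \<longrightarrow> (\<forall>p\<in>path_image g. dist p a < 2 / real n))" for n a b g
  define \<gamma> where "\<gamma> n x = (SOME g. good n (Y n x) (Y (Suc n) x) g)" for n x
  have "\<exists>g. good n (Y n x) (Y (Suc n) x) g" for n x
  \<comment> \<open>At level 0 the two points need not share a label, so only global arcwise
    connectedness is available; hence the guard \<open>n > 0\<close> on the size bound.\<close>
  proof (cases n)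
    case 0
    then show ?thesis
      using arcwise_connected_path[OF assms(3) Y_E Y_E] by (auto simp: good_def)
  next
    case (Suc i)
    \<comment> \<open>The shared label is that of level \<open>i\<close>, one below
      \<open>n\<close>, which turns \<open>2 / Suc i\<close> into the bound
      \<open>2 / n\<close>.\<close>
    have "L i (Y n x) = L i (Y (Suc n) x)"
    proof (cases "\<exists>e\<in>E. eqv (Suc n) x e")
      case True
      then obtain e where e: "e \<in> E" "eqv (Suc n) x e" by blast
      then have "eqv n x (Y n x)" "eqv n x (Y (Suc n) x)"
        using Y_stays[of e n x] eqv_anti[of "Suc n" x e n] by auto
      then show ?thesis
        using Suc by (simp add: eqv_def)
    qed (simp add: Y_Suc)
    from label_path[OF Y_E Y_E this] show ?thesis
      using Suc by (auto simp: good_def)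
  qed
  then have \<gamma>: "good n (Y n x) (Y (Suc n) x) (\<gamma> n x)" for n x
    unfolding \<gamma>_def by (rule someI_ex)
  have \<gamma>_cong: "\<gamma> n x = \<gamma> n x'" if "eqv (Suc n) x x'" for n x x'
    using Y_cong[OF that] Y_cong[OF eqv_anti[OF that]] by (simp add: \<gamma>_def)

  \<comment> \<open>Continuous approximations\<close>
  have "\<exists>g. continuous_on UNIV g \<and> (\<forall>j\<le>m. \<forall>x\<in>(\<Inter>i<j. Z i m).
     \<exists>k\<ge>j. \<exists>z. (\<forall>i<j. L i x = L i z) \<and> g x \<in> path_image (\<gamma> k z))" for m
  proof (rule continuous_along_nested_labels[where d = "1 / Suc m" and Y = Y])
    show "L i x = L i x'" if "x \<in> Z i m" "x' \<in> Z i m" "dist x x' < 1 / real (Suc m)" for i x x'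
      using Z_sep that by blast
    show "Y n x = Y n x'" if "\<forall>i<n. L i x = L i x'" for n x x'
      using Y_cong that by (simp add: eqv_def)
    show "\<gamma> n x = \<gamma> n x'" if "\<forall>i<Suc n. L i x = L i x'" for n x x'
      using \<gamma>_cong that by (simp add: eqv_def)
  qed (use \<gamma> in \<open>auto simp: good_def\<close>)
  then obtain f where f_cont: "\<And>m. continuous_on UNIV (f m)"
    and f_path: "\<And>m j x. \<lbrakk>j \<le> m; \<forall>i<j. x \<in> Z i m\<rbrakk> \<Longrightarrow>
      \<exists>k\<ge>j. \<exists>z. eqv j x z \<and> f m x \<in> path_image (\<gamma> k z)"
    unfolding eqv_def by (metis INT_I lessThan_iff)
  \<comment> \<open>Depth 0 imposes no condition on \<open>x\<close>, so every value lies on some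
    path inside \<open>E\<close>.\<close>
  have f_E: "f m x \<in> E" for m x
    using f_path[of 0 m x] \<gamma> by (auto simp: good_def)

  \<comment> \<open>The limit map and pointwise convergence\<close>
  have "\<exists>y\<in>E. (x \<in> E \<longrightarrow> y = x) \<and>
      (\<exists>N. \<forall>j\<ge>N. \<forall>k\<ge>j. \<forall>z. eqv j x z \<longrightarrow> dist (Y k z) y < 2 / real j)" for x
  proof (cases "x \<in> E")
    case True
    \<comment> \<open>The estimate must cover all \<open>z\<close> in the cell of \<open>x\<close>,
      since \<open>f m x\<close> lies on a path belonging to such a \<open>z\<close> rather than to
      \<open>x\<close> itself.\<close>
    have "dist (Y k z) x < 2 / real j" if "j \<ge> 1" "k \<ge> j" "eqv j x z" for j k z
    proof -
      obtain i where i: "j = Suc i"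
        using \<open>j \<ge> 1\<close> by (cases j) auto
      have "eqv j x (Y k z)"
        using Y_stays[OF True eqv_sym] eqv_trans that by blast
      then show ?thesis
        using label_dist[OF True Y_E] by (simp add: eqv_def i)
    qed
    with True show ?thesis
      by blast
  next
    case False
    then obtain n where n: "x \<notin> F n"
      using E_eq by blast
    have "L n x = None"
    proof (cases "L n x")
      case (Some c)
      then have "x \<in> F n"
        using L_Some[OF Some] \<rho>_F[of c n] by auto
      with n show ?thesis by simp
    qed
    then have no_rep: "\<not> (\<exists>e\<in>E. eqv (Suc n) x e)"
      using L_E unfolding eqv_def by (metis lessI option.distinct(1))
    have "Y k z = Y (Suc n) x" if "j \<ge> Suc n" "k \<ge> j" "eqv j x z" for j k z
    proof -
      have z: "eqv (Suc n) x z"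
        using that eqv_anti by blast
      then have "\<not> (\<exists>e\<in>E. eqv (Suc n) z e)"
        using no_rep eqv_trans by blast
      then show ?thesis
        using Y_stops[of "Suc n" z k] Y_cong[OF z] that by simp
    qed
    with False Y_E show ?thesis
      by (intro bexI[of _ "Y (Suc n) x"] conjI exI[of _ "Suc n"]) auto
  qed
  then obtain r N where r_E: "\<And>x. r x \<in> E" and r_id: "\<And>x. x \<in> E \<Longrightarrow> r x = x"
    and r_Y: "\<And>x j k z. \<lbrakk>j \<ge> N x; k \<ge> j; eqv j x z\<rbrakk> \<Longrightarrow> dist (Y k z) (r x) < 2 / real j"
    by metis
  have "(\<lambda>m. f m x) \<longlonglongrightarrow> r x" for x
  proof (rule tendstoI)
    fix \<epsilon> :: real assume "\<epsilon> > 0"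
    \<comment> \<open>Half of \<open>4 / j\<close> bounds the distance from \<open>f m x\<close> to
      the start of its path, the other half the distance from there to \<open>r x\<close>.\<close>
    then obtain j where j: "j > 0" "N x \<le> j" "4 / real j < \<epsilon>"
    proof -
      obtain i where "4 / \<epsilon> < real i"
        using reals_Archimedean2 by blast
      then have "4 / \<epsilon> < real (max (Suc i) (N x))"
        by linarith
      then have "4 / real (max (Suc i) (N x)) < \<epsilon>"
        using \<open>\<epsilon> > 0\<close> by (simp add: field_simps del: of_nat_max)
      then show thesis
        by (intro that[of "max (Suc i) (N x)"]) auto
    qed
    \<comment> \<open>Only the finitely many levels below \<open>j\<close> matter, so
      \<open>x\<close> is eventually in all their separated parts at once.\<close>
    have "\<forall>\<^sub>F m in sequentially. \<forall>i\<in>{..<j}. x \<in> Z i m"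
      using Z_ev by (intro eventually_ball_finite) auto
    then show "\<forall>\<^sub>F m in sequentially. dist (f m x) (r x) < \<epsilon>"
      using eventually_ge_at_top[of j]
    proof eventually_elim
      case (elim m)
      then obtain k z where kz: "k \<ge> j" "eqv j x z" "f m x \<in> path_image (\<gamma> k z)"
        using f_path[of j m x] by auto
      then have "dist (f m x) (Y k z) < 2 / real k"
        using \<gamma>[of k z] \<open>j > 0\<close> by (simp add: good_def)
      also have "\<dots> \<le> 2 / real j"
        using kz \<open>j > 0\<close> by (simp add: frac_le)
      finally show ?case
        using r_Y[OF j(2) kz(1,2)] dist_triangle[of "f m x" "r x" "Y k z"] j(3) by simp
    qed
  qed
  with f_cont f_E r_E r_id show ?thesis
    unfolding B1_retract_def baire_one_into_def by blast
qed

end
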